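(* Let $a\in\mathbb{R}$, $0<\nu<1$, $p:\mathbb{N}_a\to(0,\infty)$, $q:\mathbb{N}_{a+1}\to[0,\infty)$, $f:\mathbb{N}_{a+1}\to\mathbb{R}$, and let $M\ge 0$ be a real number. Assume that (i) $\displaystyle\sum_{s=a+1}^{\infty}\frac{1}{p(s)}\sum_{\tau=a+1}^{s}\frac{(s-\rho(\tau))^{\overline{\nu-1}}}{\Gamma(\nu)}q(\tau)<\infty$, and (ii) $\displaystyle\sum_{s=a+1}^{\infty}\frac{1}{p(s)}\sum_{\tau=a+1}^{s}\frac{(s-\rho(\tau))^{\overline{\nu-1}}}{\Gamma(\nu)}|f(\tau)|<\infty$. Then there exists some $b\in\mathbb{N}_a$ such that the fractional difference equation $$\nabla_{b-1}^{\nu}(p\nabla y)(t)+q(t)y(\rho(t))=f(t),\qquad t\in\mathbb{N}_{b+1},$$ has a solution $y:\mathbb{N}_{b-1}\to\mathbb{R}$ which satisfies $\displaystyle\lim_{t\to\infty}y(t)=M$.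
   Context: For a real number $c$, $\mathbb{N}_c:=\{c,c+1,c+2,\dots\}$. The backward jump is $\rho(t):=t-1$, and the nabla difference is $\nabla y(t):=y(t)-y(t-1)$; $(p\nabla y)(t):=p(t)\nabla y(t)$. The generalized rising function is $t^{\overline{r}}:=\Gamma(t+r)/\Gamma(t)$ for $t,t+r\notin\{0,-1,-2,\dots\}$, with the convention $t^{\overline{r}}:=0$ if $t$ is a nonpositive integer but $t+r$ is not. Empty sums are $0$. For $c\in\mathbb{R}$, $\mu>0$ and $g:\mathbb{N}_{c+1}\to\mathbb{R}$, the nabla fractional sum of order $\mu$ based at $c$ is $$\nabla_c^{-\mu}g(t):=\frac{1}{\Gamma(\mu)}\sum_{s=c+1}^{t}(t-\rho(s))^{\overline{\mu-1}}g(s),\qquad t\in\mathbb{N}_c.$$ For $0<\nu<1$, the nabla fractional difference of order $\nu$ based at $c$ is $\nabla_c^{\nu}g(t):=\nabla\big(\nabla_c^{-(1-\nu)}g\big)(t)$, $t\in\mathbb{N}_{c+1}$. *)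

theory Defs
  imports "HOL-Analysis.Analysis"
begin

text \<open>Functions on \<open>\<nat>\<^sub>c\<close> are modelled as total functions on the reals, of which only the values
  on \<open>\<nat>\<^sub>c\<close> are relevant.\<close>

definition Nats_from :: "real \<Rightarrow> real set" where
  "Nats_from c = {c + real n | n. True}"

definition back_jump :: "real \<Rightarrow> real" where
  "back_jump t = t - 1"

definition nabla :: "(real \<Rightarrow> real) \<Rightarrow> real \<Rightarrow> real" where
  "nabla y t = y t - y (back_jump t)"

text \<open>When \<open>t + r\<close> is a nonpositive integer the rising function is not defined in the source;
  here it is then \<open>0\<close>, since \<open>Gamma\<close> is \<open>0\<close> at its poles.\<close>

definition gen_rising :: "real \<Rightarrow> real \<Rightarrow> real" where
  "gen_rising t r =
     (if t \<in> \<int>\<^sub>\<le>\<^sub>0 \<and> t + r \<notin> \<int>\<^sub>\<le>\<^sub>0 then 0 else Gamma (t + r) / Gamma t)"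

text \<open>The index set of a sum from \<open>c\<close> to \<open>t\<close> in unit steps, empty if \<open>t < c\<close>.\<close>

definition step_range :: "real \<Rightarrow> real \<Rightarrow> real set" where
  "step_range c t = {s \<in> Nats_from c. s \<le> t}"

definition nabla_sum :: "real \<Rightarrow> real \<Rightarrow> (real \<Rightarrow> real) \<Rightarrow> real \<Rightarrow> real" where
  "nabla_sum c \<mu> g t =
     1 / Gamma \<mu> * (\<Sum>s\<in>step_range (c + 1) t. gen_rising (t - back_jump s) (\<mu> - 1) * g s)"

text \<open>Meant for \<open>0 < \<nu> < 1\<close>.\<close>

definition nabla_diff :: "real \<Rightarrow> real \<Rightarrow> (real \<Rightarrow> real) \<Rightarrow> real \<Rightarrow> real" where
  "nabla_diff c \<nu> g t = nabla (nabla_sum c (1 - \<nu>) g) t"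

lemma step_range_conv: "step_range c (c + real n) = (\<lambda>k. c + real k) ` {..n}"
  by (auto simp: step_range_def Nats_from_def)

lemma finite_step_range: "finite (step_range c t)"
proof (rule finite_subset)
  show "step_range c t \<subseteq> (\<lambda>k. c + real k) ` {..nat \<lfloor>t - c\<rfloor>}"
    by (auto simp: step_range_def Nats_from_def le_nat_iff le_floor_iff)
qed simp

end

theory Submission
  imports Defs
begin

text \<open>Require \<open>y (b - 1) = y b\<close>. Inverting the fractional difference then turns the equation into the
  linear recursion
  \<open>y t = y (t - 1) + 1 / p t * (\<Sum>\<tau>=b+1..t. H (t - \<tau>) * (f \<tau> - q \<tau> * y (\<tau> - 1)))\<close> for \<open>t > b\<close>,
  where \<open>H j = pochhammer \<nu> j / j!\<close>. For \<open>b\<close> large the total weight of the \<open>q\<close>-part is below \<open>1/2\<close>, so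
  every solution converges, and the homogeneous solution starting at \<open>1\<close> has a nonzero limit. The
  limit is an affine, nonconstant function of \<open>y b\<close> and hence takes the value \<open>M\<close>.\<close>

section \<open>Discrete Volterra recursions with a prescribed limit\<close>

fun volterra :: "(nat \<Rightarrow> nat \<Rightarrow> real) \<Rightarrow> (nat \<Rightarrow> real) \<Rightarrow> real \<Rightarrow> nat \<Rightarrow> real" where
  "volterra B w x 0 = x"
| "volterra B w x (Suc n) = volterra B w x n + w n + (\<Sum>k\<le>n. B n k * volterra B w x k)"

text \<open>Linearity of the recursion. It makes the limit an affine function of the initial value
  \<open>x\<close>.\<close>

lemma volterra_affine:
  "volterra B w x n = x * volterra B (\<lambda>_. 0) 1 n + volterra B w 0 n"
proof (induction n rule: less_induct)
  case (less n)
  show ?case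
  proof (cases n)
    case (Suc m)
    have "(\<Sum>k\<le>m. B m k * volterra B w x k) =
          (\<Sum>k\<le>m. B m k * (x * volterra B (\<lambda>_. 0) 1 k + volterra B w 0 k))"
      by (intro sum.cong refl) (use less Suc in auto)
    then show ?thesis
      using less[of m] Suc by (simp add: algebra_simps sum.distrib sum_distrib_left)
  qed auto
qed

lemma volterra_sum:
  "volterra B w x n = x + (\<Sum>i<n. w i + (\<Sum>k\<le>i. B i k * volterra B w x k))"
  by (induction n) auto

text \<open>A uniform bound on the solution makes its increments absolutely summable, and the total
  size of the increments controls \<open>l - x\<close>.\<close>

lemma volterra_convergent:
  assumes B: "summable (\<lambda>n. \<Sum>k\<le>n. \<bar>B n k\<bar>)" and K: "(\<Sum>n. \<Sum>k\<le>n. \<bar>B n k\<bar>) < 1"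
    and w: "summable (\<lambda>n. \<bar>w n\<bar>)"
  defines "K \<equiv> (\<Sum>n. \<Sum>k\<le>n. \<bar>B n k\<bar>)" and "W \<equiv> (\<Sum>n. \<bar>w n\<bar>)"
  obtains l where "volterra B w x \<longlonglongrightarrow> l" "\<bar>l - x\<bar> \<le> W + K * ((\<bar>x\<bar> + W) / (1 - K))"
proof -
  \<comment> \<open>\<open>C\<close> is the root of \<open>C = \<bar>x\<bar> + W + K * C\<close>, so
    the bound \<open>C\<close> on all earlier values reproduces itself at the next index.\<close>
  define C where "C = (\<bar>x\<bar> + W) / (1 - K)"
  define d where "d i = w i + (\<Sum>k\<le>i. B i k * volterra B w x k)" for i
  have C: "\<bar>x\<bar> + W + K * C = C"
    using K by (simp add: C_def K_def[symmetric] field_simps)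
  have Wn: "(\<Sum>i<n. \<bar>w i\<bar>) \<le> W" and Kn: "(\<Sum>i<n. \<Sum>k\<le>i. \<bar>B i k\<bar>) \<le> K" for n
    unfolding W_def K_def using w B by (auto intro!: sum_le_suminf sum_nonneg)
  \<comment> \<open>The empty sum in \<open>Wn[of 0]\<close> gives \<open>0 \<le> W\<close>.\<close>
  have C0: "C \<ge> 0"
    using K Wn[of 0] by (simp add: C_def K_def[symmetric])
  \<comment> \<open>The bound is assumed only up to index \<open>i\<close>, since the induction for
    \<open>bound\<close> knows no more than that.\<close>
  have d_le: "\<bar>d i\<bar> \<le> \<bar>w i\<bar> + C * (\<Sum>k\<le>i. \<bar>B i k\<bar>)"
    if "\<And>k. k \<le> i \<Longrightarrow> \<bar>volterra B w x k\<bar> \<le> C" for i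
  proof -
    have "\<bar>\<Sum>k\<le>i. B i k * volterra B w x k\<bar> \<le> (\<Sum>k\<le>i. \<bar>B i k * volterra B w x k\<bar>)"
      by (rule sum_abs)
    also have "\<dots> \<le> (\<Sum>k\<le>i. C * \<bar>B i k\<bar>)"
      using that by (intro sum_mono) (simp add: abs_mult mult.commute[of C] mult_left_mono)
    finally show ?thesis unfolding d_def by (simp add: sum_distrib_left)
  qed
  have sum_d: "(\<Sum>i<n. \<bar>w i\<bar> + C * (\<Sum>k\<le>i. \<bar>B i k\<bar>)) \<le> W + K * C" for n
    using add_mono[OF Wn[of n] mult_left_mono[OF Kn[of n] C0]]
    by (simp add: sum.distrib sum_distrib_left mult.commute)
  have bound: "\<bar>volterra B w x n\<bar> \<le> C" for n
  proof (induction n rule: less_induct)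
    case (less n)
    have "\<bar>\<Sum>i<n. d i\<bar> \<le> (\<Sum>i<n. \<bar>w i\<bar> + C * (\<Sum>k\<le>i. \<bar>B i k\<bar>))"
      by (rule order_trans[OF sum_abs], intro sum_mono d_le less) auto
    then show ?case
      using sum_d[of n] C volterra_sum[of B w x n] unfolding d_def by linarith
  qed
  have summ: "summable (\<lambda>i. \<bar>w i\<bar> + C * (\<Sum>k\<le>i. \<bar>B i k\<bar>))"
    by (intro summable_add w summable_mult B)
  have "summable d"
    by (rule summable_comparison_test'[OF summ, of 0]) (use d_le bound in auto)
  then have lim: "(\<lambda>n. x + (\<Sum>i<n. d i)) \<longlonglongrightarrow> x + suminf d"
    by (intro tendsto_intros summable_LIMSEQ)
  then have "volterra B w x \<longlonglongrightarrow> x + suminf d"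
    unfolding d_def volterra_sum[symmetric] .
  moreover have "\<bar>x + suminf d - x\<bar> \<le> W + K * C"
  proof (rule tendsto_upperbound)
    show "(\<lambda>n. \<bar>x + (\<Sum>i<n. d i) - x\<bar>) \<longlonglongrightarrow> \<bar>x + suminf d - x\<bar>"
      by (intro tendsto_intros lim)
    show "\<forall>\<^sub>F n in sequentially. \<bar>x + (\<Sum>i<n. d i) - x\<bar> \<le> W + K * C"
    proof (intro always_eventually allI)
      fix n
      have "\<bar>\<Sum>i<n. d i\<bar> \<le> (\<Sum>i<n. \<bar>w i\<bar> + C * (\<Sum>k\<le>i. \<bar>B i k\<bar>))"
        by (rule order_trans[OF sum_abs], intro sum_mono d_le bound)
      then show "\<bar>x + (\<Sum>i<n. d i) - x\<bar> \<le> W + K * C"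
        using sum_d[of n] by simp
    qed
  qed simp
  ultimately show thesis
    using that unfolding C_def by blast
qed

lemma volterra_prescribed_limit:
  assumes B: "summable (\<lambda>n. \<Sum>k\<le>n. \<bar>B n k\<bar>)" and K: "(\<Sum>n. \<Sum>k\<le>n. \<bar>B n k\<bar>) < 1/2"
    and w: "summable (\<lambda>n. \<bar>w n\<bar>)"
  obtains x where "volterra B w x \<longlonglongrightarrow> M"
proof -
  define K where "K = (\<Sum>n. \<Sum>k\<le>n. \<bar>B n k\<bar>)"
  have K1: "K < 1" and K2: "K < 1/2" using K by (auto simp: K_def)
  obtain l where l: "volterra B (\<lambda>_. 0) 1 \<longlonglongrightarrow> l" "\<bar>l - 1\<bar> \<le> K / (1 - K)"
    using volterra_convergent[OF B, of "\<lambda>_. 0" 1] K1 by (auto simp: K_def)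
  obtain v where v: "volterra B w 0 \<longlonglongrightarrow> v"
    using volterra_convergent[OF B _ w, of 0] K1 by (auto simp: K_def)
  \<comment> \<open>The threshold \<open>1/2\<close> enters here: the homogeneous limit
    \<open>l\<close> stays at distance less than \<open>1\<close> from its initial value
    \<open>1\<close>, hence away from \<open>0\<close>.\<close>
  have "K / (1 - K) < 1" using K2 by (simp add: divide_less_eq)
  with l have "l \<noteq> 0" by auto
  \<comment> \<open>The initial value \<open>(M - v) / l\<close> is the root of
    \<open>x * l + v = M\<close>.\<close>
  have "(\<lambda>n. (M - v) / l * volterra B (\<lambda>_. 0) 1 n + volterra B w 0 n) \<longlonglongrightarrow> (M - v) / l * l + v"
    by (intro tendsto_intros l v)
  then have "volterra B w ((M - v) / l) \<longlonglongrightarrow> M"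
    using \<open>l \<noteq> 0\<close> unfolding volterra_affine[symmetric] by simp
  then show thesis by (rule that)
qed

section \<open>Fractional sums as products of power series\<close>

text \<open>The coefficient of \<open>X^j\<close> in the binomial series of
  \<open>(1 - X)^(-\<mu>)\<close>.\<close>

definition rising_coeff :: "real \<Rightarrow> nat \<Rightarrow> real" where
  "rising_coeff \<mu> j = pochhammer \<mu> j / fact j"

lemma rising_coeff_nonneg: "0 \<le> \<mu> \<Longrightarrow> 0 \<le> rising_coeff \<mu> j"
  by (cases "\<mu> = 0") (auto simp: rising_coeff_def pochhammer_0_left intro!: divide_nonneg_pos less_imp_le[OF pochhammer_pos])

text \<open>The left side is \<open>Gamma (\<mu> + j) / (Gamma \<mu> * j!)\<close>, and
  \<open>Gamma (\<mu> + j) / Gamma \<mu>\<close> is a Pochhammer symbol.\<close>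

lemma gen_rising_eq_rising_coeff:
  assumes "0 < \<mu>"
  shows "gen_rising (real j + 1) (\<mu> - 1) / Gamma \<mu> = rising_coeff \<mu> j"
proof -
  have nz: "\<mu> \<notin> \<int>\<^sub>\<le>\<^sub>0" using assms by (auto elim!: nonpos_Ints_cases)
  have "real j + 1 \<notin> \<int>\<^sub>\<le>\<^sub>0" by (auto elim!: nonpos_Ints_cases)
  then have "gen_rising (real j + 1) (\<mu> - 1) = Gamma (\<mu> + real j) / Gamma (1 + real j)"
    by (simp add: gen_rising_def algebra_simps)
  moreover have "Gamma (1 + real j) = fact j" by (rule Gamma_fact)
  ultimately show ?thesis
    using pochhammer_Gamma[OF nz, of j] by (simp add: rising_coeff_def)
qed

text \<open>The exponent law for powers of \<open>1 - X\<close>. Coefficientwise it is the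
  Vandermonde convolution, once the common sign \<open>(- 1) ^ n\<close> is factored out.\<close>

lemma fps_rising_coeff_mult:
  "Abs_fps (rising_coeff \<mu>) * Abs_fps (rising_coeff \<eta>) = Abs_fps (rising_coeff (\<mu> + \<eta>))"
proof -
  have coeff: "rising_coeff x n = (- 1) ^ n * ((- x) gchoose n)" for x n
    by (simp add: rising_coeff_def gbinomial_pochhammer)
  have "(\<Sum>i=0..n. rising_coeff \<mu> i * rising_coeff \<eta> (n - i)) =
        (\<Sum>i=0..n. (- 1) ^ n * (((- \<mu>) gchoose i) * ((- \<eta>) gchoose (n - i))))" for n
    by (intro sum.cong refl) (auto simp: coeff algebra_simps simp flip: power_add)
  also have "\<dots> n = rising_coeff (\<mu> + \<eta>) n" for n
    using gbinomial_Vandermonde[of "- \<mu>" "- \<eta>" n]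
    by (simp add: coeff atMost_atLeast0 flip: sum_distrib_left)
  finally show ?thesis
    by (simp add: fps_eq_iff fps_mult_nth)
qed

text \<open>For \<open>t = c + 1 + n\<close> and \<open>s = c + 1 + k\<close> the kernel argument
  \<open>t - back_jump s\<close> is \<open>(n - k) + 1\<close>, so the defining sum is a Cauchy
  product.\<close>

lemma nabla_sum_eq:
  assumes "0 < \<mu>"
  shows "nabla_sum c \<mu> g (c + 1 + real n) =
    fps_nth (Abs_fps (rising_coeff \<mu>) * Abs_fps (\<lambda>k. g (c + 1 + real k))) n"
proof -
  have inj: "inj_on (\<lambda>k. c + 1 + real k) {..n}" by (auto simp: inj_on_def)
  have "nabla_sum c \<mu> g (c + 1 + real n) =
    (\<Sum>k\<le>n. gen_rising (real (n - k) + 1) (\<mu> - 1) / Gamma \<mu> * g (c + 1 + real k))"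
    unfolding nabla_sum_def step_range_conv sum.reindex[OF inj] sum_distrib_left
    by (intro sum.cong refl) (simp add: back_jump_def of_nat_diff algebra_simps)
  also have "\<dots> = (\<Sum>k\<le>n. g (c + 1 + real k) * rising_coeff \<mu> (n - k))"
    by (intro sum.cong refl) (metis gen_rising_eq_rising_coeff[OF assms] mult.commute)
  finally show ?thesis
    by (simp add: mult.commute[of "Abs_fps (rising_coeff \<mu>)"] fps_mult_nth atMost_atLeast0)
qed

text \<open>The fractional sums of orders \<open>1 - \<nu>\<close> and \<open>\<nu>\<close> compose to ordinary summation.\<close>

lemma nabla_diff_fractional_sum:
  assumes "0 < \<nu>" "\<nu> < 1"
    and g: "\<And>n. g (c + 1 + real n) = (\<Sum>k\<le>n. rising_coeff \<nu> (n - k) * h k)"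
  shows "nabla_diff c \<nu> g (c + 2 + real n) = h (Suc n)"
proof -
  have "Abs_fps (\<lambda>n. g (c + 1 + real n)) = Abs_fps (rising_coeff \<nu>) * Abs_fps h"
    by (simp add: g fps_eq_iff mult.commute[of "Abs_fps (rising_coeff \<nu>)"] fps_mult_nth
        atMost_atLeast0 mult.commute)
  \<comment> \<open>The orders add up to \<open>1\<close>, and every \<open>rising_coeff 1 n\<close>
    equals \<open>1\<close> because \<open>pochhammer 1 n = n!\<close>.\<close>
  then have S: "nabla_sum c (1 - \<nu>) g (c + 1 + real n) = (\<Sum>k\<le>n. h k)" for n
    using assms fps_rising_coeff_mult[of "1 - \<nu>" \<nu>]
    by (simp add: nabla_sum_eq mult.assoc[symmetric] mult.commute[of "Abs_fps (rising_coeff 1)"]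
        fps_mult_nth rising_coeff_def pochhammer_fact[symmetric] atMost_atLeast0)
  \<comment> \<open>The difference of the partial sums at \<open>Suc n\<close> and \<open>n\<close>
    leaves the last term; \<open>h 0\<close> never appears.\<close>
  show ?thesis
    using S[of n] S[of "Suc n"]
    by (simp add: nabla_diff_def nabla_def back_jump_def algebra_simps)
qed

section \<open>Choice of the base point and construction of the solution\<close>

text \<open>Moving the base from \<open>a\<close> to \<open>a + m\<close> while keeping the outer
  point drops the first \<open>m\<close> terms of the inner sum, all nonnegative. Tails of the
  assumed series thus bound the kernel based at \<open>b\<close>.\<close>

lemma kernel_shift_le:
  fixes m :: nat
  assumes "0 < \<nu>" and p: "\<And>t. t \<in> Nats_from a \<Longrightarrow> 0 < p t"
    and r: "\<And>t. t \<in> Nats_from (a + 1) \<Longrightarrow> 0 \<le> r t"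
    and F: "\<And>n. F n = (let s = a + 1 + real n in
           1 / p s * (\<Sum>\<tau>\<in>step_range (a + 1) s.
             gen_rising (s - back_jump \<tau>) (\<nu> - 1) / Gamma \<nu> * r \<tau>))"
  shows "(\<Sum>k\<le>n. rising_coeff \<nu> (n - k) * r (a + real m + 1 + real k) / p (a + real m + 1 + real n))
           \<le> F (n + m)"
proof -
  have inj: "inj_on (\<lambda>k. a + 1 + real k) {..n + m}" by (auto simp: inj_on_def)
  define P where "P = p (a + real m + 1 + real n)"
  have P: "P > 0"
    unfolding P_def by (rule p) (auto simp: Nats_from_def intro!: exI[of _ "m + 1 + n"])
  have "F (n + m) = (\<Sum>j\<le>n + m. gen_rising (real (n + m - j) + 1) (\<nu> - 1) / Gamma \<nu> * r (a + 1 + real j) / P)"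
    unfolding F Let_def step_range_conv sum.reindex[OF inj] sum_distrib_left P_def
    by (intro sum.cong refl) (simp add: back_jump_def of_nat_diff algebra_simps)
  also have "\<dots> = (\<Sum>j\<le>n + m. rising_coeff \<nu> (n + m - j) * r (a + 1 + real j) / P)"
    by (simp only: gen_rising_eq_rising_coeff[OF assms(1)])
  also have "\<dots> \<ge> (\<Sum>j\<in>(\<lambda>k. k + m) ` {..n}. rising_coeff \<nu> (n + m - j) * r (a + 1 + real j) / P)"
    using assms(1) P
    by (intro sum_mono2) (auto intro!: divide_nonneg_pos mult_nonneg_nonneg rising_coeff_nonneg r
        simp: Nats_from_def)
  finally show ?thesis
    by (simp add: sum.reindex inj_on_def P_def algebra_simps)
qed

theorem theorem2p3:
  fixes a \<nu> M :: real and p q f :: "real \<Rightarrow> real"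
  assumes "0 < \<nu>" and "\<nu> < 1"
    and "\<And>t. t \<in> Nats_from a \<Longrightarrow> 0 < p t"
    and "\<And>t. t \<in> Nats_from (a + 1) \<Longrightarrow> 0 \<le> q t"
    and "0 \<le> M"
    and "summable (\<lambda>n. let s = a + 1 + real n in
           1 / p s * (\<Sum>\<tau>\<in>step_range (a + 1) s.
             gen_rising (s - back_jump \<tau>) (\<nu> - 1) / Gamma \<nu> * q \<tau>))"
    and "summable (\<lambda>n. let s = a + 1 + real n in
           1 / p s * (\<Sum>\<tau>\<in>step_range (a + 1) s.
             gen_rising (s - back_jump \<tau>) (\<nu> - 1) / Gamma \<nu> * \<bar>f \<tau>\<bar>))"
  shows "\<exists>b \<in> Nats_from a. \<exists>y :: real \<Rightarrow> real.
           (\<forall>t \<in> Nats_from (b + 1).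
              nabla_diff (b - 1) \<nu> (\<lambda>t. p t * nabla y t) t + q t * y (back_jump t) = f t) \<and>
           (\<lambda>n. y (b - 1 + real n)) \<longlonglongrightarrow> M"
proof -
  define Q where "Q n = (let s = a + 1 + real n in
           1 / p s * (\<Sum>\<tau>\<in>step_range (a + 1) s.
             gen_rising (s - back_jump \<tau>) (\<nu> - 1) / Gamma \<nu> * q \<tau>))" for n
  define F where "F n = (let s = a + 1 + real n in
           1 / p s * (\<Sum>\<tau>\<in>step_range (a + 1) s.
             gen_rising (s - back_jump \<tau>) (\<nu> - 1) / Gamma \<nu> * \<bar>f \<tau>\<bar>))" for n
  have Q: "summable Q" and F: "summable F"
    using assms(6,7) by (simp_all add: Q_def[abs_def] F_def[abs_def])
  obtain m where "norm (\<Sum>i. Q (i + m)) < 1/2"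
    using suminf_exist_split[OF _ Q, of "1/2"] by auto
  then have m: "(\<Sum>i. Q (i + m)) < 1/2" by simp
  define b where "b = a + real m"
  have b: "b \<in> Nats_from a" by (auto simp: b_def Nats_from_def)
  define c where "c n k = rising_coeff \<nu> (n - k) / p (b + 1 + real n)" for n k
  \<comment> \<open>The sign comes from moving \<open>q t * y (back_jump t)\<close> to the right; at
    \<open>t = b + 1 + k\<close> it involves the value at \<open>b + k\<close>, which has index
    \<open>k\<close> in the recursion.\<close>
  define B where "B n k = - (c n k * q (b + 1 + real k))" for n k
  define w where "w n = (\<Sum>k\<le>n. c n k * f (b + 1 + real k))" for n
  have p: "p (b + 1 + real n) > 0" for n
    unfolding b_def by (rule assms(3)) (auto simp: Nats_from_def intro!: exI[of _ "m + 1 + n"])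
  have c: "c n k \<ge> 0" for n k
    using assms(1) by (auto simp: c_def intro!: divide_nonneg_pos rising_coeff_nonneg p)
  have q: "q (b + 1 + real k) \<ge> 0" for k
    unfolding b_def by (rule assms(4)) (auto simp: Nats_from_def intro!: exI[of _ "m + k"])
  have BQ: "(\<Sum>k\<le>n. \<bar>B n k\<bar>) \<le> Q (n + m)" for n
  proof -
    have "\<bar>B n k\<bar> = c n k * q (b + 1 + real k)" for k
      using c[of n k] q[of k] by (simp add: B_def abs_mult)
    then show ?thesis
      using kernel_shift_le[OF assms(1,3,4) Q_def] by (simp add: c_def b_def)
  qed
  have "(\<Sum>k\<le>n. c n k * \<bar>f (b + 1 + real k)\<bar>) \<le> F (n + m)" for n
    using kernel_shift_le[OF assms(1,3) _ F_def] by (simp add: c_def b_def)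
  moreover have "\<bar>w n\<bar> \<le> (\<Sum>k\<le>n. c n k * \<bar>f (b + 1 + real k)\<bar>)" for n
    unfolding w_def by (rule order_trans[OF sum_abs]) (use c in \<open>simp add: abs_mult\<close>)
  ultimately have wF: "\<bar>w n\<bar> \<le> F (n + m)" for n
    by (rule order_trans[rotated])
  have Qm: "summable (\<lambda>n. Q (n + m))" and Fm: "summable (\<lambda>n. F (n + m))"
    using Q F by (auto simp: summable_iff_shift)
  have B: "summable (\<lambda>n. \<Sum>k\<le>n. \<bar>B n k\<bar>)"
    by (rule summable_comparison_test'[OF Qm, of 0]) (use BQ in \<open>auto simp: sum_nonneg\<close>)
  moreover have "(\<Sum>n. \<Sum>k\<le>n. \<bar>B n k\<bar>) < 1/2"
    using suminf_le[OF BQ B Qm] m by simp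
  moreover have "summable (\<lambda>n. \<bar>w n\<bar>)"
    by (rule summable_comparison_test'[OF Fm, of 0]) (use wF in auto)
  ultimately obtain x where lim: "volterra B w x \<longlonglongrightarrow> M"
    using volterra_prescribed_limit by blast
  define Y where "Y = volterra B w x"
  \<comment> \<open>For \<open>t = b - 1\<close> the cutoff by \<open>nat\<close> gives
    \<open>Y 0\<close>, so \<open>y (b - 1) = y b\<close> and \<open>nabla y b = 0\<close>.\<close>
  define y where "y t = Y (nat \<lfloor>t - b\<rfloor>)" for t
  \<comment> \<open>Index \<open>k\<close> stands for the point \<open>b + k\<close>. The value
    \<open>0\<close> at index \<open>0\<close> matches \<open>nabla y b = 0\<close>; later values
    are the right side \<open>f - q y\<close> of the equation.\<close>
  define h where "h k = (case k of 0 \<Rightarrow> 0 | Suc j \<Rightarrow> f (b + 1 + real j) - q (b + 1 + real j) * Y j)" for k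
  have y: "y (b + real n) = Y n" "y (b - 1 + real n) = Y (n - 1)" for n
    by (simp_all add: y_def nat_diff_distrib')
  have g: "p (b - 1 + 1 + real n) * nabla y (b - 1 + 1 + real n) = (\<Sum>k\<le>n. rising_coeff \<nu> (n - k) * h k)"
    for n
  proof (cases n)
    case 0
    then show ?thesis
      using y(1)[of 0] y(2)[of 0] by (simp add: h_def nabla_def back_jump_def)
  next
    case (Suc j)
    have "nabla y (b + 1 + real j) = Y (Suc j) - Y j"
      using y(1)[of "Suc j"] y(1)[of j] by (simp add: nabla_def back_jump_def algebra_simps)
    also have "\<dots> = (\<Sum>k\<le>j. c j k * h (Suc k))"
      by (simp add: Y_def w_def B_def h_def algebra_simps sum_subtractf sum_negf)
    finally have "p (b + 1 + real j) * nabla y (b + 1 + real j) = (\<Sum>k\<le>j. rising_coeff \<nu> (j - k) * h (Suc k))"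
      using p[of j] by (simp add: sum_distrib_left c_def)
    moreover have "h 0 = 0" by (simp add: h_def)
    \<comment> \<open>Since \<open>h 0 = 0\<close>, the convolution up to \<open>Suc j\<close> is
      the one up to \<open>j\<close> with \<open>h\<close> shifted by one.\<close>
    ultimately show ?thesis
      unfolding Suc sum.atMost_Suc_shift by (simp add: algebra_simps)
  qed
  have "nabla_diff (b - 1) \<nu> (\<lambda>t. p t * nabla y t) t + q t * y (back_jump t) = f t"
    if t_in: "t \<in> Nats_from (b + 1)" for t
  proof -
    obtain n where t: "t = b + 1 + real n" using t_in by (auto simp: Nats_from_def)
    \<comment> \<open>With base \<open>c = b - 1\<close>, the point \<open>c + 2 + n\<close> is
      exactly \<open>t\<close>.\<close>
    then have "nabla_diff (b - 1) \<nu> (\<lambda>t. p t * nabla y t) t = h (Suc n)"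
      using nabla_diff_fractional_sum[where g = "\<lambda>t. p t * nabla y t", OF assms(1,2) g, of n]
      by (simp add: algebra_simps)
    then show ?thesis
      using y(1)[of n] by (simp add: t h_def back_jump_def algebra_simps)
  qed
  moreover have "(\<lambda>n. y (b - 1 + real n)) \<longlonglongrightarrow> M"
    \<comment> \<open>Passing to successors removes the truncated subtraction in
      \<open>Y (n - 1)\<close>.\<close>
    unfolding y(2) by (rule LIMSEQ_imp_Suc) (use lim in \<open>simp add: Y_def\<close>)
  ultimately show ?thesis
    using b by blast
qed

end
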